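(* Fix any $c>1/e$ and $d\ge0$. For all sufficiently large $T$, there exists $V$ such that for every probability distribution $P_{T,V}$ over protocols in $\tilde\Pi_{T,V}$, there exists a type $\mathbf v\in\tilde{\mathcal V}_{T,V}$ with $\mathbb E_{\pi\sim P_{T,V}}[{\sf Rev}_\pi(\mathbf v)]\le cV-d$.
   Context: Single-buyer game over $T$ rounds with known total value. Let $\varepsilon_T=T^{-100}$. $\tilde{\mathcal V}_{T,V}$ is the (finite) set of types $\mathbf v=(v_1,\dots,v_T)$ with each $v_t\in[0,1]$ an integer multiple of $\varepsilon_T$ and $\sum_tv_t=V$. A protocol over $\tilde{\mathcal V}_{T,V}$ specifies for each $\mathbf v$ allocations $r_{\mathbf v,t}\in[0,1]$, prices $x_{\mathbf v,t}$ and a reimbursement $g_{\mathbf v}$ (buyer receives $r_{\mathbf v,t}$ in round $t$, must pay $x_{\mathbf v,t}$ or be eliminated, and gets $g_{\mathbf v}$ at the end). It is $\varepsilon_T$-discrete if all $r,x,g$ values are multiples of $\varepsilon_T$, and $\varepsilon_T$-truthful if $x_{\mathbf v,t}\le r_{\mathbf v,t}v_t+10\varepsilon_T$ for all $\mathbf v,t$, and for all $\mathbf v,\mathbf v'\in\tilde{\mathcal V}_{T,V}$ and $\tau\le T$ with $x_{\mathbf v',t}\le r_{\mathbf v',t}v_t+10\varepsilon_T$ for all $t\le\tau$: $\sum_{t=1}^T(r_{\mathbf v,t}v_t-x_{\mathbf v,t})+g_{\mathbf v}\ge\sum_{t=1}^\tau(r_{\mathbf v',t}v_t-x_{\mathbf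 v',t})+g_{\mathbf v'}\mathbf 1(\tau=T)-10\varepsilon_TT$. $\tilde\Pi_{T,V}$ is the set of $\varepsilon_T$-discrete, $\varepsilon_T$-truthful protocols over $\tilde{\mathcal V}_{T,V}$. Revenue is ${\sf Rev}_\pi(\mathbf v)=\sum_tx_{\mathbf v,t}-g_{\mathbf v}$. *)

theory Defs
  imports "HOL-Probability.Probability"
begin

text \<open>Rounds are indexed 1..T. A type is a function nat => real, zero outside 1..T.
A protocol is a triple (r, x, g) of allocation, price and reimbursement maps.\<close>

type_synonym btype = "nat \<Rightarrow> real"
type_synonym protocol =
  "(btype \<Rightarrow> nat \<Rightarrow> real) \<times> (btype \<Rightarrow> nat \<Rightarrow> real) \<times> (btype \<Rightarrow> real)"

definition epsT :: "nat \<Rightarrow> real" where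
  "epsT T = 1 / (real T) ^ 100"

definition multiple_of :: "real \<Rightarrow> real \<Rightarrow> bool" where
  "multiple_of e a \<longleftrightarrow> (\<exists>k::int. a = of_int k * e)"

definition types :: "nat \<Rightarrow> real \<Rightarrow> btype set" where
  "types T V = {v. (\<forall>t\<in>{1..T}. 0 \<le> v t \<and> v t \<le> 1 \<and> multiple_of (epsT T) (v t))
                 \<and> (\<forall>t. t \<notin> {1..T} \<longrightarrow> v t = 0)
                 \<and> (\<Sum>t=1..T. v t) = V}"

definition alloc :: "protocol \<Rightarrow> btype \<Rightarrow> nat \<Rightarrow> real" where
  "alloc \<pi> = fst \<pi>"
definition price :: "protocol \<Rightarrow> btype \<Rightarrow> nat \<Rightarrow> real" where
  "price \<pi> = fst (snd \<pi>)"
definition reimb :: "protocol \<Rightarrow> btype \<Rightarrow> real" where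
  "reimb \<pi> = snd (snd \<pi>)"

definition discrete_protocol :: "nat \<Rightarrow> real \<Rightarrow> protocol \<Rightarrow> bool" where
  "discrete_protocol T V \<pi> \<longleftrightarrow>
     (\<forall>v\<in>types T V.
        (\<forall>t\<in>{1..T}. 0 \<le> alloc \<pi> v t \<and> alloc \<pi> v t \<le> 1
            \<and> multiple_of (epsT T) (alloc \<pi> v t) \<and> multiple_of (epsT T) (price \<pi> v t))
        \<and> multiple_of (epsT T) (reimb \<pi> v))"

definition truthful_protocol :: "nat \<Rightarrow> real \<Rightarrow> protocol \<Rightarrow> bool" where
  "truthful_protocol T V \<pi> \<longleftrightarrow>
     (\<forall>v\<in>types T V. \<forall>t\<in>{1..T}. price \<pi> v t \<le> alloc \<pi> v t * v t + 10 * epsT T)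
     \<and> (\<forall>v\<in>types T V. \<forall>v'\<in>types T V. \<forall>\<tau>::nat. \<tau> \<le> T \<longrightarrow>
          (\<forall>t\<in>{1..\<tau>}. price \<pi> v' t \<le> alloc \<pi> v' t * v t + 10 * epsT T) \<longrightarrow>
          (\<Sum>t=1..T. alloc \<pi> v t * v t - price \<pi> v t) + reimb \<pi> v
            \<ge> (\<Sum>t=1..\<tau>. alloc \<pi> v' t * v t - price \<pi> v' t)
               + (if \<tau> = T then reimb \<pi> v' else 0) - 10 * epsT T * real T)"

definition Pi_tilde :: "nat \<Rightarrow> real \<Rightarrow> protocol set" where
  "Pi_tilde T V = {\<pi>. discrete_protocol T V \<pi> \<and> truthful_protocol T V \<pi>}"

definition Rev :: "nat \<Rightarrow> protocol \<Rightarrow> btype \<Rightarrow> real" where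
  "Rev T \<pi> v = (\<Sum>t=1..T. price \<pi> v t) - reimb \<pi> v"

end

theory Submission
  imports Defs
begin

text \<open>Let U(v) be the expected utility of type v. Take a type w that is constant on blocks of rounds
  and let w_b follow w up to block b and then spend its whole remaining value uniformly on block b.
  Since w_b may imitate w through block b and then leave, U(w_b) is at least the average allocation
  of w on block b times the value left to w after that block. If every U(w_b) is at most X, the
  allocation at the moment when value \<rho> is left is thus at most min(1, X / \<rho>), so the welfare
  of w is at most X * ln(V / \<rho>) until \<rho> = V / e, and V / e afterwards, in total X + V / e.
  Hence if all revenues exceed V / e by a margin, some jump to w_b raises U by that margin.
  Subdividing the blocks and repeating, U would eventually exceed V, which is impossible.\<close>

section \<open>Welfare bound along a declining remaining value\<close>

text \<open>Down to \<open>V / exp 1\<close> the sum is dominated by the integral of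
  \<open>Z / \<rho>\<close>, which is \<open>Z * ln (exp 1) = Z\<close>. The one drop crossing that
  threshold costs at most \<open>h\<close>, and below it \<open>y \<le> 1\<close> leaves at most
  \<open>V / exp 1\<close>.\<close>

lemma declining_sum_bound:
  fixes \<rho> y :: "nat \<Rightarrow> real"
  assumes V: "\<rho> 0 = V" "0 < V" and Z: "0 \<le> Z" and h: "0 \<le> h"
    and dec: "\<And>b. b < m \<Longrightarrow> \<rho> (Suc b) \<le> \<rho> b"
    and step: "\<And>b. b < m \<Longrightarrow> \<rho> b - \<rho> (Suc b) \<le> h"
    and y: "\<And>b. b < m \<Longrightarrow> 0 \<le> y b" "\<And>b. b < m \<Longrightarrow> y b \<le> 1"
    and early: "\<And>b. \<lbrakk>b < m; V / exp 1 \<le> \<rho> (Suc b)\<rbrakk> \<Longrightarrow> y b * \<rho> b \<le> Z"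
    and nonneg: "0 \<le> \<rho> m"
  shows "(\<Sum>b<m. y b * (\<rho> b - \<rho> (Suc b))) \<le> Z + V / exp 1 + h"
proof -
  define A where "A = V / exp 1"
  have A: "0 < A" using V by (simp add: A_def)
  have ln_le: "ln (V / x) \<le> 1" if "A \<le> x" for x
  proof -
    have "0 < x" using that A by simp
    moreover have "V / x \<le> exp 1" using that \<open>0 < x\<close> by (simp add: A_def field_simps)
    ultimately show ?thesis using V ln_le_cancel_iff[of "V / x" "exp 1"] by simp
  qed
  \<comment> \<open>The invariant changes at the threshold \<open>A\<close>: above it a telescoping
    logarithm, below it every drop is charged in full to the fall of \<open>\<rho> k\<close>, with
    \<open>h\<close> reserved for the crossing drop.\<close>
  have "(\<Sum>b<k. y b * (\<rho> b - \<rho> (Suc b)))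
      \<le> (if A \<le> \<rho> k then Z * ln (V / \<rho> k) else Z + A + h - \<rho> k)" if "k \<le> m" for k
    using that
  proof (induction k)
    case 0
    have "A \<le> V" using V by (simp add: A_def divide_le_eq)
    then show ?case using V by simp
  next
    case (Suc k)
    then have k: "k < m" by simp
    have yk: "y k * (\<rho> k - \<rho> (Suc k)) \<le> \<rho> k - \<rho> (Suc k)"
      using y[OF k] dec[OF k] by (simp add: mult_left_le_one_le)
    consider (before) "A \<le> \<rho> (Suc k)" | (crossing) "A \<le> \<rho> k" "\<rho> (Suc k) < A"
      | (late) "\<rho> k < A" "\<rho> (Suc k) < A"
      using dec[OF k] by fastforce
    then show ?case
    proof cases
      case before
      have pos: "0 < \<rho> (Suc k)" "0 < \<rho> k" and Ak: "A \<le> \<rho> k"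
        using before A dec[OF k] by auto
      \<comment> \<open>Factoring out \<open>y k * \<rho> k\<close>, which \<open>early\<close>
        bounds by \<open>Z\<close>, leaves the relative drop; \<open>1 - x \<le> - ln x\<close>
        turns it into a logarithm.\<close>
      have "y k * (\<rho> k - \<rho> (Suc k)) = y k * \<rho> k * (1 - \<rho> (Suc k) / \<rho> k)"
        using pos by (simp add: field_simps)
      also have "\<dots> \<le> Z * (1 - \<rho> (Suc k) / \<rho> k)"
        using early[OF k] before pos dec[OF k] by (intro mult_right_mono) (auto simp: A_def)
      also have "\<dots> \<le> Z * ln (\<rho> k / \<rho> (Suc k))"
        using ln_le_minus_one[of "\<rho> (Suc k) / \<rho> k"] pos Z
        by (intro mult_left_mono) (auto simp: ln_div)
      finally have "y k * (\<rho> k - \<rho> (Suc k)) \<le> Z * ln (\<rho> k / \<rho> (Suc k))" .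
      moreover have "Z * ln (V / \<rho> k) + Z * ln (\<rho> k / \<rho> (Suc k)) = Z * ln (V / \<rho> (Suc k))"
        using pos V by (simp add: ln_div algebra_simps)
      ultimately show ?thesis using Suc before Ak by simp
    next
      case crossing
      have "Z * ln (V / \<rho> k) \<le> Z" using Z ln_le[OF crossing(1)] by (simp add: mult_left_le)
      moreover have "(\<Sum>b<k. y b * (\<rho> b - \<rho> (Suc b))) \<le> Z * ln (V / \<rho> k)"
        using Suc k crossing by simp
      ultimately have "(\<Sum>b<Suc k. y b * (\<rho> b - \<rho> (Suc b))) \<le> Z + A + h - \<rho> (Suc k)"
        unfolding sum.lessThan_Suc using yk crossing step[OF k] by linarith
      then show ?thesis using crossing by simp
    next
      case late
      then show ?thesis using Suc yk by simp
    qed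
  qed
  from this[of m] have main: "(\<Sum>b<m. y b * (\<rho> b - \<rho> (Suc b)))
      \<le> (if A \<le> \<rho> m then Z * ln (V / \<rho> m) else Z + A + h - \<rho> m)" by simp
  show ?thesis
  proof (cases "A \<le> \<rho> m")
    case True
    have "Z * ln (V / \<rho> m) \<le> Z" using Z ln_le[OF True] by (simp add: mult_left_le)
    then show ?thesis using main True A h by (simp add: A_def)
  next
    case False
    then show ?thesis using main nonneg by (simp add: A_def)
  qed
qed

section \<open>Block-constant types and their integer profiles\<close>

text \<open>Block \<open>j\<close> consists of the rounds \<open>j * L + 1\<close> to
  \<open>j * L + L\<close>. Round 0 is treated apart because truncated subtraction would put it into
  block 0.\<close>

definition block_type :: "real \<Rightarrow> nat \<Rightarrow> (nat \<Rightarrow> nat) \<Rightarrow> btype" where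
  "block_type \<delta> L a t = (if t = 0 then 0 else \<delta> * real (a ((t - 1) div L)))"

text \<open>With as many units as blocks, the total value is \<open>\<delta>\<close> times the
  number \<open>L * m\<close> of covered rounds, which does not change when blocks are
  subdivided.\<close>

definition profile :: "nat \<Rightarrow> (nat \<Rightarrow> nat) \<Rightarrow> bool" where
  "profile m a \<longleftrightarrow> (\<forall>j\<ge>m. a j = 0) \<and> (\<Sum>j<m. a j) = m"

text \<open>The profile of w_b when \<open>a\<close> is that of w.\<close>

definition jump :: "nat \<Rightarrow> nat \<Rightarrow> (nat \<Rightarrow> nat) \<Rightarrow> nat \<Rightarrow> nat" where
  "jump m b a j = (if j < b then a j else if j = b then \<Sum>i\<in>{b..<m}. a i else 0)"

lemma profile_le: "a j \<le> m" if "profile m a"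
proof (cases "j < m")
  case True
  then have "a j \<le> (\<Sum>j<m. a j)" by (intro member_le_sum) auto
  then show ?thesis using that by (simp add: profile_def)
qed (use that in \<open>simp add: profile_def\<close>)

lemma profile_split: "(\<Sum>i<b. a i) + (\<Sum>i\<in>{b..<m}. a i) = m" if "profile m a" "b \<le> m"
  using that sum.atLeastLessThan_concat[of 0 b m a] by (simp add: profile_def atLeast0LessThan)

lemma profile_jump: "profile m (jump m b a)" if "profile m a" "b < m"
proof -
  have "(\<Sum>j<m. jump m b a j) = (\<Sum>j<b. jump m b a j) + (\<Sum>j\<in>{b..<m}. jump m b a j)"
    using that sum.atLeastLessThan_concat[of 0 b m "jump m b a"] by (simp add: atLeast0LessThan)
  also have "(\<Sum>j<b. jump m b a j) = (\<Sum>j<b. a j)" by (simp add: jump_def)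
  also have "(\<Sum>j\<in>{b..<m}. jump m b a j) = jump m b a b + (\<Sum>j\<in>{Suc b..<m}. jump m b a j)"
    using that by (simp add: sum.atLeast_Suc_lessThan)
  also have "(\<Sum>j\<in>{Suc b..<m}. jump m b a j) = 0" by (simp add: jump_def)
  finally have "(\<Sum>j<m. jump m b a j) = m" using that profile_split[of m a b] by (simp add: jump_def)
  then show ?thesis using that by (simp add: profile_def jump_def)
qed

lemma profile_refine: "profile (m * n) (\<lambda>j. a (j div n))" if "profile m a" "0 < n"
proof -
  have "(\<Sum>j<m * n. a (j div n)) = (\<Sum>i<m. \<Sum>j\<in>{i * n..<i * n + n}. a (j div n))"
    by (rule sum.nat_group[symmetric])
  also have "\<dots> = (\<Sum>i<m. \<Sum>j\<in>{i * n..<i * n + n}. a i)"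
  proof (intro sum.cong refl)
    fix i j assume "j \<in> {i * n..<i * n + n}"
    then have "j div n = i" by (intro div_nat_eqI) (auto simp: algebra_simps)
    then show "a (j div n) = a i" by simp
  qed
  also have "\<dots> = m * n" using that by (simp add: profile_def flip: sum_distrib_left)
  finally show ?thesis using that by (auto simp: profile_def less_eq_div_iff_mult_less_eq)
qed

text \<open>Subdividing changes only the description of a type, so utility gained at a coarse scale
  survives the passage to a finer one.\<close>

lemma block_type_refine: "block_type \<delta> (L * n) a = block_type \<delta> L (\<lambda>j. a (j div n))"
  by (simp add: block_type_def fun_eq_iff div_mult2_eq)

text \<open>Both the total value and the welfare are read off from this regrouping; rounds beyond
  \<open>L * m\<close> have value zero.\<close>

lemma sum_block_type:
  assumes "profile m a" "L * m \<le> T" "0 < L"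
  shows "(\<Sum>t=1..T. f t * block_type \<delta> L a t)
       = \<delta> * (\<Sum>b<m. real (a b) * (\<Sum>s\<in>{b * L..<b * L + L}. f (Suc s)))"
proof -
  have "(\<Sum>t=1..T. f t * block_type \<delta> L a t) = (\<Sum>s<T. f (Suc s) * (\<delta> * real (a (s div L))))"
    by (simp add: sum.atLeast1_atMost_eq block_type_def)
  also have "\<dots> = (\<Sum>s<m * L. f (Suc s) * (\<delta> * real (a (s div L))))"
  proof (rule sum.mono_neutral_right)
    show "\<forall>s\<in>{..<T} - {..<m * L}. f (Suc s) * (\<delta> * real (a (s div L))) = 0"
      using assms by (auto simp: profile_def less_eq_div_iff_mult_less_eq)
  qed (use assms in \<open>auto simp: mult.commute\<close>)
  also have "\<dots> = (\<Sum>b<m. \<Sum>s\<in>{b * L..<b * L + L}. f (Suc s) * (\<delta> * real (a (s div L))))"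
    by (rule sum.nat_group[symmetric])
  also have "\<dots> = (\<Sum>b<m. \<Sum>s\<in>{b * L..<b * L + L}. \<delta> * real (a b) * f (Suc s))"
  proof (intro sum.cong refl)
    fix b s assume "s \<in> {b * L..<b * L + L}"
    then have "s div L = b" by (intro div_nat_eqI) (auto simp: algebra_simps)
    then show "f (Suc s) * (\<delta> * real (a (s div L))) = \<delta> * real (a b) * f (Suc s)" by simp
  qed
  finally show ?thesis by (simp add: sum_distrib_left mult.assoc)
qed

text \<open>The bound \<open>\<delta> * real m \<le> 1\<close> lets a single block hold all
  \<open>m\<close> units, so types produced by jumps stay admissible.\<close>

lemma block_type_in_types:
  assumes a: "profile m a" "L * m \<le> T" "0 < L"
    and \<delta>: "\<delta> = real q * epsT T" "\<delta> * real m \<le> 1"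
  shows "block_type \<delta> L a \<in> types T (\<delta> * real (L * m))"
proof -
  have \<delta>0: "0 \<le> \<delta>" using \<delta> by (simp add: epsT_def)
  have "block_type \<delta> L a t \<le> 1" for t
  proof -
    have "\<delta> * real (a ((t - 1) div L)) \<le> \<delta> * real m"
      using profile_le[OF a(1)] \<delta>0 by (intro mult_left_mono) auto
    then show ?thesis using \<delta> by (simp add: block_type_def)
  qed
  moreover have "multiple_of (epsT T) (block_type \<delta> L a t)" for t
    unfolding multiple_of_def block_type_def using \<delta>(1)
    by (intro exI[of _ "if t = 0 then 0 else int (q * a ((t - 1) div L))"]) auto
  moreover have "block_type \<delta> L a t = 0" if "t \<notin> {1..T}" for t
  proof (cases "t = 0")
    case False
    with that have "T \<le> t - 1" by auto
    then have "m \<le> (t - 1) div L" using a by (simp add: less_eq_div_iff_mult_less_eq mult.commute)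
    then show ?thesis using a by (simp add: block_type_def profile_def)
  qed (simp add: block_type_def)
  moreover have "(\<Sum>t=1..T. block_type \<delta> L a t) = \<delta> * real (L * m)"
  proof -
    have "(\<Sum>b<m. real (a b) * real L) = real m * real L"
      using a by (metis profile_def of_nat_sum sum_distrib_right)
    then show ?thesis using sum_block_type[OF a, of "\<lambda>_. 1" \<delta>] by simp
  qed
  moreover have "0 \<le> block_type \<delta> L a t" for t using \<delta>0 by (simp add: block_type_def)
  ultimately show ?thesis by (simp add: types_def)
qed

section \<open>Iterated jumps under averaged constraints\<close>

text \<open>R and Rv are the expected allocations and revenues of a random protocol; e collects the
  slack of approximate truthfulness.\<close>

locale averaged_protocol =
  fixes T :: nat and V e :: real and R :: "btype \<Rightarrow> nat \<Rightarrow> real" and Rv :: "btype \<Rightarrow> real"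
  assumes R: "\<lbrakk>v \<in> types T V; t \<in> {1..T}\<rbrakk> \<Longrightarrow> 0 \<le> R v t \<and> R v t \<le> 1"
    and participation: "v \<in> types T V \<Longrightarrow> - e \<le> (\<Sum>t=1..T. R v t * v t) - Rv v"
    and deviation: "\<lbrakk>v \<in> types T V; v' \<in> types T V; \<tau> < T; \<And>t. t \<in> {1..\<tau>} \<Longrightarrow> v' t \<le> v t\<rbrakk>
       \<Longrightarrow> (\<Sum>t=1..\<tau>. R v' t * (v t - v' t)) - e \<le> (\<Sum>t=1..T. R v t * v t) - Rv v"
begin

definition U :: "btype \<Rightarrow> real" where
  "U v = (\<Sum>t=1..T. R v t * v t) - Rv v"

text \<open>Utility and revenue share a welfare of at most \<open>V\<close>; this is the cap that
  the iteration finally violates.\<close>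

lemma U_le: "U v \<le> V - Rv v" if "v \<in> types T V"
proof -
  have "(\<Sum>t=1..T. R v t * v t) \<le> (\<Sum>t=1..T. v t)"
    using R[OF that] that by (intro sum_mono) (auto simp: types_def mult_left_le_one_le)
  then show ?thesis using that by (simp add: U_def types_def)
qed

text \<open>The jump type imitates w through block \<open>b\<close> and leaves. The two types differ
  only on block \<open>b\<close> up to then, by exactly the units w holds after it.
  \<open>Suc b < m\<close> makes the exit precede round \<open>T\<close>, as
  \<open>deviation\<close> requires.\<close>

lemma U_jump:
  assumes a: "profile m a" "L * m \<le> T" "0 < L" and \<delta>: "0 \<le> \<delta>" and b: "Suc b < m"
    and V: "block_type \<delta> L a \<in> types T V" "block_type \<delta> L (jump m b a) \<in> types T V"
  shows "\<delta> * real (\<Sum>i\<in>{Suc b..<m}. a i) * (\<Sum>s\<in>{b * L..<b * L + L}. R (block_type \<delta> L a) (Suc s)) - e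
       \<le> U (block_type \<delta> L (jump m b a))"
proof -
  let ?w = "block_type \<delta> L a" and ?w' = "block_type \<delta> L (jump m b a)"
  let ?\<tau> = "b * L + L"
  have rest: "(\<Sum>i\<in>{b..<m}. a i) = a b + (\<Sum>i\<in>{Suc b..<m}. a i)"
    using b by (simp add: sum.atLeast_Suc_lessThan)
  have "?\<tau> = Suc b * L" by simp
  also have "\<dots> < m * L" using b a by (intro mult_strict_right_mono) auto
  finally have \<tau>: "?\<tau> < T" using a by (simp add: mult.commute)
  have before: "?w' (Suc s) - ?w (Suc s) = 0" if "s < b * L" for s
  proof -
    have "s div L < b" using that a by (simp add: less_mult_imp_div_less)
    then show ?thesis by (simp add: block_type_def jump_def)
  qed
  have at: "?w' (Suc s) - ?w (Suc s) = \<delta> * real (\<Sum>i\<in>{Suc b..<m}. a i)" if "s \<in> {b * L..<?\<tau>}" for s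
  proof -
    have "s div L = b" using that by (intro div_nat_eqI) (auto simp: algebra_simps)
    then show ?thesis by (simp add: block_type_def jump_def rest algebra_simps del: of_nat_sum)
  qed
  have "?w t \<le> ?w' t" if "t \<in> {1..?\<tau>}" for t
  proof -
    define s where "s = t - 1"
    then have s: "t = Suc s" "s < ?\<tau>" using that by auto
    have "0 \<le> ?w' (Suc s) - ?w (Suc s)"
    proof (cases "s < b * L")
      case False
      then show ?thesis using s at[of s] \<delta> by (simp del: of_nat_sum)
    qed (simp add: before)
    then show ?thesis using s by simp
  qed
  from deviation[OF V(2) V(1) \<tau> this]
  have dev: "(\<Sum>t=1..?\<tau>. R ?w t * (?w' t - ?w t)) - e \<le> U ?w'" by (simp add: U_def)
  have "(\<Sum>t=1..?\<tau>. R ?w t * (?w' t - ?w t)) = (\<Sum>s<?\<tau>. R ?w (Suc s) * (?w' (Suc s) - ?w (Suc s)))"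
    by (simp add: sum.atLeast1_atMost_eq)
  also have "\<dots> = (\<Sum>s\<in>{b * L..<?\<tau>}. R ?w (Suc s) * (?w' (Suc s) - ?w (Suc s)))"
    using before by (intro sum.mono_neutral_right) auto
  also have "\<dots> = (\<Sum>s\<in>{b * L..<?\<tau>}. R ?w (Suc s) * (\<delta> * real (\<Sum>i\<in>{Suc b..<m}. a i)))"
    by (intro sum.cong refl) (simp only: at)
  also have "\<dots> = \<delta> * real (\<Sum>i\<in>{Suc b..<m}. a i) * (\<Sum>s\<in>{b * L..<?\<tau>}. R ?w (Suc s))"
    by (simp only: mult.commute flip: sum_distrib_right)
  finally show ?thesis using dev by simp
qed

text \<open>If no jump gained \<open>\<gamma>\<close>, \<open>declining_sum_bound\<close> would cap
  the welfare of w at \<open>U w + \<gamma> + e + V / exp 1 + 2 * V / n\<close>, while the assumed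
  revenue pushes it higher. The condition \<open>a j * n \<le> m\<close> says that no block carries
  more than a fraction \<open>1 / n\<close> of \<open>V\<close>.\<close>

lemma exists_better_jump:
  assumes a: "profile m a" "L * m \<le> T" "0 < L" "0 < m"
    and \<delta>: "\<delta> = real q * epsT T" "\<delta> * real m \<le> 1" "0 < \<delta>"
    and V: "V = \<delta> * real (L * m)"
    and n: "0 < n" "\<And>j. a j * n \<le> m"
    and Rv: "\<And>v. v \<in> types T V \<Longrightarrow> V / exp 1 + 2 * V / real n + e + \<gamma> < Rv v" and \<gamma>: "0 \<le> \<gamma>"
  shows "\<exists>b<m. U (block_type \<delta> L a) + \<gamma> \<le> U (block_type \<delta> L (jump m b a))"
proof (rule ccontr)
  assume "\<not> ?thesis"
  then have less: "\<And>b. b < m \<Longrightarrow> U (block_type \<delta> L (jump m b a)) < U (block_type \<delta> L a) + \<gamma>" by force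
  let ?w = "block_type \<delta> L a"
  \<comment> \<open>The term \<open>V / real n\<close> pays for replacing the value left after a
    block by the value left before it.\<close>
  define Z where "Z = U ?w + \<gamma> + e + V / real n"
  \<comment> \<open>\<open>y b\<close> is the average allocation on block \<open>b\<close>, and
    \<open>\<rho> b\<close> the value left just before it.\<close>
  define y where "y b = (\<Sum>s\<in>{b * L..<b * L + L}. R ?w (Suc s)) / real L" for b
  define \<rho> where "\<rho> b = \<delta> * real L * real (\<Sum>i\<in>{b..<m}. a i)" for b
  have w: "?w \<in> types T V" using block_type_in_types[OF a(1-3) \<delta>(1,2)] V by simp
  have Vpos: "0 < V" using V a \<delta> by simp
  have \<rho>_Suc: "\<rho> b - \<rho> (Suc b) = \<delta> * real L * real (a b)" if "b < m" for b
    using that by (simp add: \<rho>_def sum.atLeast_Suc_lessThan algebra_simps)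
  have step: "\<rho> b - \<rho> (Suc b) \<le> V / real n" if "b < m" for b
  proof -
    have "real (a b) * real n \<le> real m" using n(2)[of b] by (metis of_nat_le_iff of_nat_mult)
    then have "\<delta> * real L * (real (a b) * real n) \<le> \<delta> * real L * real m"
      using \<delta> by (intro mult_left_mono) auto
    then show ?thesis using n V by (simp add: \<rho>_Suc[OF that] field_simps)
  qed
  have y: "0 \<le> y b" "y b \<le> 1" if "b < m" for b
  proof -
    have "Suc b * L \<le> m * L" using that by (intro mult_right_mono) auto
    then have "b * L + L \<le> T" using a by (simp add: algebra_simps)
    then have R': "0 \<le> R ?w (Suc s)" "R ?w (Suc s) \<le> 1" if "s \<in> {b * L..<b * L + L}" for s
      using R[OF w, of "Suc s"] that by auto
    show "0 \<le> y b" unfolding y_def by (intro divide_nonneg_nonneg sum_nonneg) (auto simp: R')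
    have "(\<Sum>s\<in>{b * L..<b * L + L}. R ?w (Suc s)) \<le> (\<Sum>s\<in>{b * L..<b * L + L}. 1)"
      by (intro sum_mono R')
    then show "y b \<le> 1" using a by (simp add: y_def)
  qed
  have early: "y b * \<rho> b \<le> Z" if b: "b < m" and \<rho>: "V / exp 1 \<le> \<rho> (Suc b)" for b
  proof -
    have "0 < V / exp 1" using Vpos by simp
    with \<rho> have "0 < \<rho> (Suc b)" by linarith
    \<comment> \<open>After the last block nothing is left, so a positive remainder excludes
      it.\<close>
    then have "Suc b < m" unfolding \<rho>_def by (cases "Suc b < m") auto
    moreover have "block_type \<delta> L (jump m b a) \<in> types T V"
      using block_type_in_types[OF profile_jump[OF a(1) b] a(2,3) \<delta>(1,2)] V by simp
    ultimately have "y b * \<rho> (Suc b) - e \<le> U (block_type \<delta> L (jump m b a))"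
      using U_jump[OF a(1-3) _ _ w, of b] \<delta> a
      by (simp add: y_def \<rho>_def mult_ac del: of_nat_sum)
    with less[OF b] have "y b * \<rho> (Suc b) \<le> U ?w + \<gamma> + e" by simp
    moreover have "y b * (\<rho> b - \<rho> (Suc b)) \<le> V / real n"
      using y[OF b] step[OF b] \<rho>_Suc[OF b] \<delta>
      by (intro order_trans[OF mult_left_le_one_le]) auto
    ultimately show ?thesis by (simp add: Z_def algebra_simps)
  qed
  have "(\<Sum>b<m. y b * (\<rho> b - \<rho> (Suc b))) \<le> Z + V / exp 1 + V / real n"
  proof (rule declining_sum_bound)
    show "\<rho> 0 = V" using a V by (simp add: \<rho>_def profile_def atLeast0LessThan flip: of_nat_sum)
    \<comment> \<open>Participation gives \<open>U w \<ge> - e\<close>, which the summand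
      \<open>e\<close> in \<open>Z\<close> offsets.\<close>
    show "0 \<le> Z" using participation[OF w] \<gamma> Vpos by (simp add: Z_def U_def)
    show "\<rho> (Suc b) \<le> \<rho> b" if "b < m" for b
    proof -
      have "0 \<le> \<rho> b - \<rho> (Suc b)" unfolding \<rho>_Suc[OF that] using \<delta>(3) by simp
      then show ?thesis by simp
    qed
  qed (use Vpos y step early in \<open>auto simp: \<rho>_def\<close>)
  moreover have "(\<Sum>b<m. y b * (\<rho> b - \<rho> (Suc b))) = (\<Sum>t=1..T. R ?w t * ?w t)"
    unfolding sum_block_type[OF a(1-3)] sum_distrib_left[of \<delta>]
    using a by (intro sum.cong refl) (simp add: \<rho>_Suc y_def mult_ac)
  ultimately have "U ?w + Rv ?w \<le> Z + V / exp 1 + V / real n" by (simp add: U_def)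
  with Rv[OF w] show False by (simp add: Z_def)
qed

text \<open>Stage \<open>i\<close> uses \<open>n ^ i\<close> blocks of length
  \<open>N * n ^ (K - i)\<close>. Each stage subdivides every block into \<open>n\<close> parts and
  then jumps, gaining \<open>\<gamma>\<close>.\<close>

lemma exists_high_utility:
  assumes N: "0 < N" and n: "0 < n" and T: "N * n ^ K \<le> T"
    and \<delta>: "\<delta> = real q * epsT T" "\<delta> * real (n ^ K) \<le> 1" "0 < \<delta>"
    and V: "V = \<delta> * real (N * n ^ K)"
    and Rv: "\<And>v. v \<in> types T V \<Longrightarrow> V / exp 1 + 2 * V / real n + e + \<gamma> < Rv v" and \<gamma>: "0 \<le> \<gamma>"
  shows "\<exists>v\<in>types T V. real K * \<gamma> - e \<le> U v"
proof -
  have pow: "N * n ^ (K - i) * n ^ i = N * n ^ K" if "i \<le> K" for i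
    using that by (simp flip: power_add)
  have small: "\<delta> * real (n ^ i) \<le> 1" if "i \<le> K" for i
  proof -
    have "\<delta> * real (n ^ i) \<le> \<delta> * real (n ^ K)"
      using that n \<delta> by (intro mult_left_mono) (auto intro: power_increasing)
    then show ?thesis using \<delta> by simp
  qed
  have mem: "block_type \<delta> (N * n ^ (K - i)) a \<in> types T V" if "i \<le> K" "profile (n ^ i) a" for i a
    using block_type_in_types[OF that(2) _ _ \<delta>(1) small[OF that(1)], of "N * n ^ (K - i)"]
      pow[OF that(1)] T V N n by simp
  have "\<exists>a. profile (n ^ i) a \<and> real i * \<gamma> - e \<le> U (block_type \<delta> (N * n ^ (K - i)) a)"
    if "i \<le> K" for i
    using that
  proof (induction i)
    case 0
    \<comment> \<open>The start is one block with one unit, that is, a constant value on all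
      \<open>N * n ^ K\<close> rounds.\<close>
    have "profile (n ^ 0) (\<lambda>j. if j = 0 then 1 else 0)" by (simp add: profile_def)
    with participation[OF mem[OF _ this]] show ?case by (auto simp: U_def)
  next
    case (Suc i)
    then obtain a where a: "profile (n ^ i) a"
      and Ua: "real i * \<gamma> - e \<le> U (block_type \<delta> (N * n ^ (K - i)) a)" by auto
    let ?L = "N * n ^ (K - Suc i)" and ?a = "\<lambda>j. a (j div n)"
    have "K - i = Suc (K - Suc i)" using Suc by simp
    then have L: "N * n ^ (K - i) = ?L * n" by simp
    have pa: "profile (n ^ Suc i) ?a" using profile_refine[OF a n] by (simp add: mult.commute)
    have "\<exists>b<n ^ Suc i. U (block_type \<delta> ?L ?a) + \<gamma> \<le> U (block_type \<delta> ?L (jump (n ^ Suc i) b ?a))"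
    proof (rule exists_better_jump[OF pa _ _ _ \<delta>(1) small \<delta>(3) _ n _ Rv \<gamma>])
      \<comment> \<open>A jump may pile everything into one block; subdividing makes each block
        small again, because a coarse entry is at most \<open>n ^ i\<close>.\<close>
      show "a (j div n) * n \<le> n ^ Suc i" for j
        using profile_le[OF a, of "j div n"] by simp
      show "V = \<delta> * real (?L * n ^ Suc i)" by (simp only: V pow[OF Suc.prems])
      show "?L * n ^ Suc i \<le> T" by (simp only: T pow[OF Suc.prems])
    qed (use Suc N n in auto)
    then obtain b where b: "b < n ^ Suc i"
      and "U (block_type \<delta> ?L ?a) + \<gamma> \<le> U (block_type \<delta> ?L (jump (n ^ Suc i) b ?a))" by blast
    then have "real (Suc i) * \<gamma> - e \<le> U (block_type \<delta> ?L (jump (n ^ Suc i) b ?a))"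
      using Ua unfolding L block_type_refine by (simp add: algebra_simps)
    then show ?case using profile_jump[OF pa b] by blast
  qed
  then obtain a where "profile (n ^ K) a" "real K * \<gamma> - e \<le> U (block_type \<delta> (N * n ^ (K - K)) a)"
    by blast
  with mem[of K a] show ?thesis by blast
qed

end

section \<open>From random protocols to expectations\<close>

text \<open>Bounding the prices of the imitated type leaves inequalities linear in allocations and
  revenue, which survive expectation. The slack is \<open>10 * epsT T * real T\<close> from
  truthfulness plus at most \<open>10 * epsT T\<close> for each imitated round.\<close>

lemma averaged_protocol_pmf:
  assumes P: "set_pmf P \<subseteq> Pi_tilde T V" and T: "0 < T"
    and int: "\<And>v. v \<in> types T V \<Longrightarrow> integrable (measure_pmf P) (\<lambda>\<pi>. Rev T \<pi> v)"
  shows "averaged_protocol T V (20 * epsT T * real T)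
    (\<lambda>v t. measure_pmf.expectation P (\<lambda>\<pi>. alloc \<pi> v t))
    (\<lambda>v. measure_pmf.expectation P (\<lambda>\<pi>. Rev T \<pi> v))"
proof -
  let ?E = "measure_pmf.expectation P"
  have eps: "0 < epsT T" using T by (simp add: epsT_def)
  have alloc: "0 \<le> alloc \<pi> v t" "alloc \<pi> v t \<le> 1"
    if "\<pi> \<in> set_pmf P" "v \<in> types T V" "t \<in> {1..T}" for \<pi> v t
    using that P by (auto simp: Pi_tilde_def discrete_protocol_def)
  have ia: "integrable (measure_pmf P) (\<lambda>\<pi>. alloc \<pi> v t)" if "v \<in> types T V" "t \<in> {1..T}" for v t
    by (rule measure_pmf.integrable_const_bound[where B = 1])
      (use alloc[OF _ that] in \<open>auto simp: AE_measure_pmf_iff\<close>)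
  have isum: "integrable (measure_pmf P) (\<lambda>\<pi>. \<Sum>t\<in>A. alloc \<pi> v t * f t)"
    and Esum: "?E (\<lambda>\<pi>. \<Sum>t\<in>A. alloc \<pi> v t * f t) = (\<Sum>t\<in>A. ?E (\<lambda>\<pi>. alloc \<pi> v t) * f t)"
    if "v \<in> types T V" "A \<subseteq> {1..T}" for v A and f :: "nat \<Rightarrow> real"
  proof -
    have i: "integrable (measure_pmf P) (\<lambda>\<pi>. alloc \<pi> v t * f t)" if "t \<in> A" for t
      using ia[of v t] that \<open>v \<in> types T V\<close> \<open>A \<subseteq> {1..T}\<close> by (intro integrable_mult_left) auto
    then show "integrable (measure_pmf P) (\<lambda>\<pi>. \<Sum>t\<in>A. alloc \<pi> v t * f t)"
      by (intro Bochner_Integration.integrable_sum)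
    show "?E (\<lambda>\<pi>. \<Sum>t\<in>A. alloc \<pi> v t * f t) = (\<Sum>t\<in>A. ?E (\<lambda>\<pi>. alloc \<pi> v t) * f t)"
      using i by (simp add: Bochner_Integration.integral_sum)
  qed
  have iu: "integrable (measure_pmf P) (\<lambda>\<pi>. (\<Sum>t=1..T. alloc \<pi> v t * v t) - Rev T \<pi> v)"
    and Eu: "?E (\<lambda>\<pi>. (\<Sum>t=1..T. alloc \<pi> v t * v t) - Rev T \<pi> v)
      = (\<Sum>t=1..T. ?E (\<lambda>\<pi>. alloc \<pi> v t) * v t) - ?E (\<lambda>\<pi>. Rev T \<pi> v)" if "v \<in> types T V" for v
    using isum[OF that, of "{1..T}" v] Esum[OF that, of "{1..T}" v] int[OF that] by simp_all
  have price: "price \<pi> v t \<le> alloc \<pi> v t * v t + 10 * epsT T"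
    if "\<pi> \<in> set_pmf P" "v \<in> types T V" "t \<in> {1..T}" for \<pi> v t
    using that P by (auto simp: Pi_tilde_def truthful_protocol_def)
  have truth: "(\<Sum>t=1..\<tau>. alloc \<pi> v' t * v t - price \<pi> v' t) - 10 * epsT T * real T
      \<le> (\<Sum>t=1..T. alloc \<pi> v t * v t) - Rev T \<pi> v"
    if "\<pi> \<in> set_pmf P" "v \<in> types T V" "v' \<in> types T V" "\<tau> < T"
      "\<And>t. t \<in> {1..\<tau>} \<Longrightarrow> price \<pi> v' t \<le> alloc \<pi> v' t * v t + 10 * epsT T" for \<pi> v v' \<tau>
  proof -
    have "truthful_protocol T V \<pi>" using that(1) P by (auto simp: Pi_tilde_def)
    then have "(\<Sum>t=1..\<tau>. alloc \<pi> v' t * v t - price \<pi> v' t)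
               + (if \<tau> = T then reimb \<pi> v' else 0) - 10 * epsT T * real T
        \<le> (\<Sum>t=1..T. alloc \<pi> v t * v t - price \<pi> v t) + reimb \<pi> v"
      unfolding truthful_protocol_def using that(2-5) by (meson less_imp_le)
    then show ?thesis using that(4) by (simp add: Rev_def sum_subtractf)
  qed
  have dev: "(\<Sum>t=1..\<tau>. ?E (\<lambda>\<pi>. alloc \<pi> v' t) * (v t - v' t)) - 20 * epsT T * real T
      \<le> (\<Sum>t=1..T. ?E (\<lambda>\<pi>. alloc \<pi> v t) * v t) - ?E (\<lambda>\<pi>. Rev T \<pi> v)"
    if v: "v \<in> types T V" "v' \<in> types T V" and \<tau>: "\<tau> < T"
      and le: "\<And>t. t \<in> {1..\<tau>} \<Longrightarrow> v' t \<le> v t" for v v' \<tau>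
  proof -
    let ?f = "\<lambda>\<pi>. (\<Sum>t=1..\<tau>. alloc \<pi> v' t * (v t - v' t)) - 20 * epsT T * real T"
    have "integrable (measure_pmf P) ?f"
      and Ef: "?E ?f = (\<Sum>t=1..\<tau>. ?E (\<lambda>\<pi>. alloc \<pi> v' t) * (v t - v' t)) - 20 * epsT T * real T"
      using isum[OF v(2), of "{1..\<tau>}" "\<lambda>t. v t - v' t"] Esum[OF v(2), of "{1..\<tau>}" "\<lambda>t. v t - v' t"] \<tau>
      by simp_all
    moreover have "?f \<pi> \<le> (\<Sum>t=1..T. alloc \<pi> v t * v t) - Rev T \<pi> v" if \<pi>: "\<pi> \<in> set_pmf P" for \<pi>
    proof -
      \<comment> \<open>Since \<open>v' \<le> v\<close> on these rounds, imitation is affordable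
        under every protocol in the support, so one deviation serves all of them.\<close>
      have "price \<pi> v' t \<le> alloc \<pi> v' t * v t + 10 * epsT T" if t: "t \<in> {1..\<tau>}" for t
      proof -
        have "t \<in> {1..T}" using t \<tau> by auto
        moreover from this have "alloc \<pi> v' t * v' t \<le> alloc \<pi> v' t * v t"
          using le[OF t] alloc(1)[OF \<pi> v(2)] by (intro mult_left_mono) auto
        ultimately show ?thesis using price[OF \<pi> v(2), of t] by linarith
      qed
      from truth[OF \<pi> v \<tau> this]
      have 1: "(\<Sum>t=1..\<tau>. alloc \<pi> v' t * v t - price \<pi> v' t) - 10 * epsT T * real T
        \<le> (\<Sum>t=1..T. alloc \<pi> v t * v t) - Rev T \<pi> v" by simp
      have "(\<Sum>t=1..\<tau>. alloc \<pi> v' t * (v t - v' t) - 10 * epsT T)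
          \<le> (\<Sum>t=1..\<tau>. alloc \<pi> v' t * v t - price \<pi> v' t)"
      proof (rule sum_mono)
        fix t assume "t \<in> {1..\<tau>}"
        then show "alloc \<pi> v' t * (v t - v' t) - 10 * epsT T \<le> alloc \<pi> v' t * v t - price \<pi> v' t"
          using price[OF \<pi> v(2), of t] \<tau> by (simp add: algebra_simps)
      qed
      then have "(\<Sum>t=1..\<tau>. alloc \<pi> v' t * (v t - v' t)) - real \<tau> * (10 * epsT T)
          \<le> (\<Sum>t=1..\<tau>. alloc \<pi> v' t * v t - price \<pi> v' t)" by (simp add: sum_subtractf)
      moreover have "real \<tau> * (10 * epsT T) \<le> real T * (10 * epsT T)"
        using \<tau> eps by (intro mult_right_mono) auto
      ultimately show ?thesis using 1 by (simp add: algebra_simps)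
    qed
    ultimately have "?E ?f \<le> ?E (\<lambda>\<pi>. (\<Sum>t=1..T. alloc \<pi> v t * v t) - Rev T \<pi> v)"
      by (intro integral_mono_AE iu[OF v(1)]) (auto simp: AE_measure_pmf_iff)
    then show ?thesis unfolding Ef Eu[OF v(1)] .
  qed
  show ?thesis
  proof
    fix v t assume vt: "v \<in> types T V" "t \<in> {1..T}"
    show "0 \<le> ?E (\<lambda>\<pi>. alloc \<pi> v t) \<and> ?E (\<lambda>\<pi>. alloc \<pi> v t) \<le> 1"
    proof
      show "0 \<le> ?E (\<lambda>\<pi>. alloc \<pi> v t)"
        using alloc(1)[OF _ vt] by (intro integral_nonneg_AE) (auto simp: AE_measure_pmf_iff)
      show "?E (\<lambda>\<pi>. alloc \<pi> v t) \<le> 1"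
        using alloc(2)[OF _ vt] ia[OF vt]
        by (intro measure_pmf.integral_le_const) (auto simp: AE_measure_pmf_iff)
    qed
  next
    fix v assume "v \<in> types T V"
    then show "- (20 * epsT T * real T)
        \<le> (\<Sum>t=1..T. ?E (\<lambda>\<pi>. alloc \<pi> v t) * v t) - ?E (\<lambda>\<pi>. Rev T \<pi> v)"
      \<comment> \<open>Participation is the deviation that leaves before the first round.\<close>
      using dev[of v v 0] T by simp
  qed (use dev in blast)
qed

section \<open>Choice of parameters and final contradiction\<close>

theorem theorem22:
  fixes c d :: real
  assumes "c > 1 / exp 1" and "d \<ge> 0"
  shows "\<exists>T0::nat. \<forall>T\<ge>T0. \<exists>V::real. \<forall>P :: protocol pmf.
           set_pmf P \<subseteq> Pi_tilde T V \<longrightarrow>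
           (\<exists>v\<in>types T V.
              integrable (measure_pmf P) (\<lambda>\<pi>. Rev T \<pi> v) \<longrightarrow>
              measure_pmf.expectation P (\<lambda>\<pi>. Rev T \<pi> v) \<le> c * V - d)"
proof -
  define \<kappa> where "\<kappa> = c - 1 / exp 1"
  have \<kappa>: "0 < \<kappa>" using assms by (simp add: \<kappa>_def)
  \<comment> \<open>Half of the margin \<open>\<kappa> * V\<close> is the gain
    \<open>\<gamma>\<close> of a jump. A quarter covers the grid error \<open>2 * V / n\<close>,
    fixing \<open>n\<close>; a quarter covers \<open>d + 1\<close>, fixing \<open>N\<close> because
    \<open>V \<ge> N / 2\<close>. Then \<open>K\<close> makes the total gain at least
    \<open>2 * V\<close>.\<close>
  define n where "n = nat \<lceil>8 / \<kappa>\<rceil>"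
  define K where "K = nat \<lceil>4 / \<kappa>\<rceil>"
  define N where "N = nat \<lceil>8 * (d + 1) / \<kappa>\<rceil> + 2"
  have n: "8 / \<kappa> \<le> real n" "0 < n" and K: "4 / \<kappa> \<le> real K"
    using \<kappa> by (auto simp: n_def K_def)
  have N: "8 * (d + 1) / \<kappa> \<le> real N" "2 \<le> N"
    using real_nat_ceiling_ge[of "8 * (d + 1) / \<kappa>"] by (auto simp: N_def)
  show ?thesis
  \<comment> \<open>The first summand makes room for the blocks; 20 ensures that the slack
    \<open>20 * epsT T * real T\<close> is at most 1.\<close>
  proof (intro exI[of _ "N * n ^ K + 20"] allI impI)
    fix T assume T0: "N * n ^ K + 20 \<le> T"
    then have T: "N * n ^ K \<le> T" "20 \<le> T" by auto
    \<comment> \<open>This makes \<open>\<delta>\<close> the largest grid multiple with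
      \<open>\<delta> * n ^ K \<le> 1\<close>.\<close>
    define q where "q = T ^ 100 div n ^ K"
    define \<delta> where "\<delta> = real q * epsT T"
    define V where "V = \<delta> * real (N * n ^ K)"
    define \<gamma> where "\<gamma> = \<kappa> / 2 * V"
    have T100: "real T ^ 100 * epsT T = 1" using T by (simp add: epsT_def)
    have epos: "0 < epsT T" using T by (simp add: epsT_def)
    have e: "20 * epsT T * real T \<le> 1"
    proof -
      have "20 * real T \<le> real T ^ 1 * real T" using T by (simp add: mult_right_mono)
      also have "\<dots> = real T ^ 2" by (simp add: power2_eq_square)
      also have "\<dots> \<le> real T ^ 100" using T by (intro power_increasing) auto
      finally have "20 * real T * epsT T \<le> real T ^ 100 * epsT T" using epos by (intro mult_right_mono) auto
      then show ?thesis unfolding T100 by (simp add: mult_ac)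
    qed
    have up: "\<delta> * real (n ^ K) \<le> 1"
    proof -
      have "q * n ^ K \<le> T ^ 100" by (simp add: q_def)
      then have "real (q * n ^ K) \<le> real T ^ 100" by (metis of_nat_le_iff of_nat_power)
      then have "real (q * n ^ K) * epsT T \<le> real T ^ 100 * epsT T" using epos by (intro mult_right_mono) auto
      then show ?thesis unfolding T100 by (simp add: \<delta>_def mult_ac)
    qed
    have low: "1 / 2 \<le> \<delta> * real (n ^ K)"
    proof -
      have "1 * n ^ K \<le> N * n ^ K" using N by (intro mult_right_mono) auto
      with T(1) have "n ^ K \<le> T" by linarith
      moreover have "2 * T \<le> T ^ 100"
      proof -
        have "2 * T \<le> T ^ 2" using T by (simp add: power2_eq_square)
        also have "\<dots> \<le> T ^ 100" using T by (intro power_increasing) auto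
        finally show ?thesis .
      qed
      \<comment> \<open>Rounding down loses less than \<open>n ^ K \<le> T\<close>, at most half of
        \<open>T ^ 100\<close>.\<close>
      moreover have "T ^ 100 < q * n ^ K + n ^ K"
        using dividend_less_div_times[of "n ^ K" "T ^ 100"] n(2)
        unfolding q_def by (simp only: zero_less_power add.commute)
      ultimately have "T ^ 100 \<le> 2 * (q * n ^ K)" by linarith
      then have "real T ^ 100 \<le> 2 * real (q * n ^ K)"
        by (metis of_nat_le_iff of_nat_mult of_nat_numeral of_nat_power)
      then have "real T ^ 100 * epsT T \<le> 2 * real (q * n ^ K) * epsT T"
        using epos by (intro mult_right_mono) auto
      then show ?thesis unfolding T100 by (simp add: \<delta>_def mult_ac)
    qed
    have \<delta>: "0 < \<delta>"
      using low by (cases "\<delta> > 0") (use mult_nonpos_nonneg[of \<delta> "real (n ^ K)"] in \<open>auto simp: not_less\<close>)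
    have VN: "real N / 2 \<le> V"
      using mult_right_mono[OF low, of "real N"] by (simp add: V_def mult_ac)
    then have V1: "1 \<le> V" using N by linarith
    have slack: "d + 1 \<le> \<kappa> / 4 * V"
    proof -
      have "8 * (d + 1) \<le> real N * \<kappa>" using N \<kappa> by (simp add: field_simps)
      also have "\<dots> \<le> 2 * V * \<kappa>" using VN \<kappa> by (intro mult_right_mono) auto
      also have "\<dots> = 8 * (\<kappa> / 4 * V)" by simp
      finally show ?thesis by (simp only: mult_le_cancel_left_pos zero_less_numeral)
    qed
    have grid: "2 * V / real n \<le> \<kappa> / 4 * V"
    proof -
      have "8 \<le> \<kappa> * real n" using n \<kappa> by (simp add: field_simps)
      then have "8 * V \<le> \<kappa> * real n * V" using V1 by (intro mult_right_mono) auto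
      then show ?thesis using n by (simp add: field_simps)
    qed
    have total: "2 * V \<le> real K * \<gamma>"
    proof -
      have "4 \<le> real K * \<kappa>" using K \<kappa> by (simp add: field_simps)
      then have "4 * V \<le> real K * \<kappa> * V" using V1 by (intro mult_right_mono) auto
      then show ?thesis by (simp add: \<gamma>_def)
    qed
    have cV: "c * V = V / exp 1 + \<kappa> * V" by (simp add: \<kappa>_def algebra_simps)
    show "\<exists>V::real. \<forall>P :: protocol pmf.
           set_pmf P \<subseteq> Pi_tilde T V \<longrightarrow>
           (\<exists>v\<in>types T V.
              integrable (measure_pmf P) (\<lambda>\<pi>. Rev T \<pi> v) \<longrightarrow>
              measure_pmf.expectation P (\<lambda>\<pi>. Rev T \<pi> v) \<le> c * V - d)"
    proof (intro exI[of _ V] allI impI, rule ccontr)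
      fix P :: "protocol pmf"
      assume P: "set_pmf P \<subseteq> Pi_tilde T V"
      assume "\<not> (\<exists>v\<in>types T V.
              integrable (measure_pmf P) (\<lambda>\<pi>. Rev T \<pi> v) \<longrightarrow>
              measure_pmf.expectation P (\<lambda>\<pi>. Rev T \<pi> v) \<le> c * V - d)"
      \<comment> \<open>The negated implication supplies integrability of the revenue for every type
        along with the strict bound.\<close>
      then have int: "\<And>v. v \<in> types T V \<Longrightarrow> integrable (measure_pmf P) (\<lambda>\<pi>. Rev T \<pi> v)"
        and high: "\<And>v. v \<in> types T V \<Longrightarrow> c * V - d < measure_pmf.expectation P (\<lambda>\<pi>. Rev T \<pi> v)"
        by (auto simp: not_le)
      interpret averaged_protocol T V "20 * epsT T * real T"
        "\<lambda>v t. measure_pmf.expectation P (\<lambda>\<pi>. alloc \<pi> v t)"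
        "\<lambda>v. measure_pmf.expectation P (\<lambda>\<pi>. Rev T \<pi> v)"
        by (rule averaged_protocol_pmf) (use P T int in auto)
      have "\<exists>v\<in>types T V. real K * \<gamma> - 20 * epsT T * real T \<le> U v"
      proof (rule exists_high_utility[OF _ n(2) T(1) \<delta>_def up \<delta> V_def])
        fix v assume "v \<in> types T V"
        from high[OF this] show "V / exp 1 + 2 * V / real n + 20 * epsT T * real T + \<gamma>
            < measure_pmf.expectation P (\<lambda>\<pi>. Rev T \<pi> v)"
          using slack grid e cV by (simp add: \<gamma>_def)
      qed (use N \<kappa> V1 in \<open>auto simp: \<gamma>_def\<close>)
      then obtain v where v: "v \<in> types T V" "real K * \<gamma> - 20 * epsT T * real T \<le> U v" by blast
      \<comment> \<open>The lower bound \<open>c * V - d\<close> on revenue is positive, so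
        \<open>U v < V\<close>; yet the iteration gives
        \<open>U v \<ge> 2 * V - 1 \<ge> V\<close>.\<close>
      have "0 < V / exp 1" using V1 by simp
      moreover have "4 * d + 4 \<le> \<kappa> * V" using slack by simp
      ultimately have "0 < V / exp 1 + \<kappa> * V - d" using assms(2) by linarith
      then show False using v U_le[OF v(1)] high[OF v(1)] total e V1 cV by linarith
    qed
  qed
qed

end
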